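(* Let $\mathcal L$ be an $M$-structure with adapted basis $1,A_1,\dots,A_p,B^1,\dots,B^p,C$ and central element $K$. Then the algebra $U(\mathcal L)$ is spanned, as a vector space, by the elements $$K^s,\quad A_iK^s,\quad B^jK^s,\quad A_iB^jK^s,\qquad i,j=1,\dots,p,\ s=0,1,2,\dots$$
   Context: A weak $M$-structure on a finite-dimensional complex vector space $\mathcal L$ consists of: two subspaces $\mathcal A,\mathcal B\subset\mathcal L$ and an element $1\in\mathcal A\cap\mathcal B$; a non-degenerate symmetric bilinear form $(\cdot,\cdot)$ on $\mathcal L$; associative products on $\mathcal A$ and on $\mathcal B$, both with unity $1$; a left (unital) action of $\mathcal B$ on $\mathcal L$ and a right (unital) action of $\mathcal A$ on $\mathcal L$ that commute with each other; such that (1) $\mathcal A\cap\mathcal B=\mathbb C\,1$ is one-dimensional and $\dim\mathcal L/(\mathcal A+\mathcal B)=1$; (2) the action of $\mathcal B$ restricted to $\mathcal B\subset\mathcal L$ is the product of $\mathcal B$, and the action of $\mathcal A$ restricted to $\mathcal A\subset\mathcal L$ is the product of $\mathcal A$; (3) $(a_1,a_2)=(b_1,b_2)=0$, $(b_1b_2,v)=(b_1,b_2v)$, $(v,a_1a_2)=(va_1,a_2)$ for all $a_1,a_2\in\mathcal A$, $b_1,b_2\in\mathcal B$, $v\in\mathcal L$. The weak $M$-algebra $U(\mathcal L)$ is the associative algebra with unit $1\in\mathcal L$ such that $\mathcal L\subset U(\mathcal L)$, the products $bv$ and $va$ ($b\in\mathcal B$, $a\in\mathcal A$, $v\in\mathcal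 L$) in $U(\mathcal L)$ are the given actions, and which is universal: for any associative algebra $X$ with these properties there is a unique algebra homomorphism $U(\mathcal L)\to X$ that is the identity on $\mathcal L$. Adapted basis: $\{1,A_1,\dots,A_p\}$ is a basis of $\mathcal A$, $\{1,B^1,\dots,B^p\}$ a basis of $\mathcal B$ with $(A_i,B^j)=\delta_i^j$, and $C\in\mathcal L$ is the unique element with $(1,C)=1$ and $(C,C)=(C,A_i)=(C,B^j)=0$ for all $i,j$. Put $K=\sum_iA_iB^i+C\in U(\mathcal L)$ (independent of the choice of adapted basis). A weak $M$-structure is called an $M$-structure if $K$ is central in $U(\mathcal L)$. *)

theory Defs
  imports Complex_Main "HOL-Algebra.Module" "Jordan_Normal_Form.VS_Connect"
begin

text \<open>
  The finite-dimensional space \<open>\<L>\<close> is a whole type \<open>'l\<close> with an explicit complex scalar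
  multiplication, so that \<open>span\<close>, \<open>dim\<close> and \<open>subspace\<close> are those of
  \<^locale>\<open>vector_space\<close>. The algebra \<open>U(\<L>)\<close>, and the algebras it is compared with, are
  HOL-Algebra records over the complex numbers, since the universal property has to range over
  algebras with arbitrary carriers and operations.
\<close>

definition bilinear_on ::
    "(complex \<Rightarrow> 'l::ab_group_add \<Rightarrow> 'l) \<Rightarrow> 'l set \<Rightarrow> 'l set \<Rightarrow> ('l \<Rightarrow> 'l \<Rightarrow> 'l) \<Rightarrow> bool" where
  "bilinear_on scale S T f \<longleftrightarrow>
     (\<forall>x\<in>S. \<forall>x'\<in>S. \<forall>y\<in>T. f (x + x') y = f x y + f x' y) \<and>
     (\<forall>x\<in>S. \<forall>y\<in>T. \<forall>y'\<in>T. f x (y + y') = f x y + f x y') \<and>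
     (\<forall>c. \<forall>x\<in>S. \<forall>y\<in>T. f (scale c x) y = scale c (f x y) \<and> f x (scale c y) = scale c (f x y))"

definition unital_product_on ::
    "(complex \<Rightarrow> 'l::ab_group_add \<Rightarrow> 'l) \<Rightarrow> 'l set \<Rightarrow> 'l \<Rightarrow> ('l \<Rightarrow> 'l \<Rightarrow> 'l) \<Rightarrow> bool" where
  "unital_product_on scale S e f \<longleftrightarrow>
     bilinear_on scale S S f \<and>
     (\<forall>x\<in>S. \<forall>y\<in>S. f x y \<in> S) \<and>
     (\<forall>x\<in>S. \<forall>y\<in>S. \<forall>z\<in>S. f (f x y) z = f x (f y z)) \<and>
     e \<in> S \<and> (\<forall>x\<in>S. f e x = x \<and> f x e = x)"

text \<open>
  \<open>lact b v\<close> is the left action \<open>bv\<close> and \<open>ract v a\<close> the right action \<open>va\<close>; \<open>mulA\<close>, \<open>mulB\<close>,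
  \<open>lact\<close> and \<open>ract\<close> are only relevant for arguments from \<open>\<A>\<close> and \<open>\<B>\<close> in the respective places.
\<close>

locale weak_M_structure = vector_space scale
  for scale :: "complex \<Rightarrow> 'l::ab_group_add \<Rightarrow> 'l"
    and \<A> \<B> :: "'l set"
    and e :: 'l
    and form :: "'l \<Rightarrow> 'l \<Rightarrow> complex"
    and mulA mulB lact ract :: "'l \<Rightarrow> 'l \<Rightarrow> 'l" +
  assumes finite_dim: "\<exists>S. finite S \<and> span S = UNIV"
    and subspace_A: "subspace \<A>"
    and subspace_B: "subspace \<B>"
    and form_sym: "form v w = form w v"
    and form_linear: "Vector_Spaces.linear scale (*) (form v)"
    and form_nondegenerate: "(\<And>w. form v w = 0) \<Longrightarrow> v = 0"
    and product_A: "unital_product_on scale \<A> e mulA"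
    and product_B: "unital_product_on scale \<B> e mulB"
    and lact_bilinear: "bilinear_on scale \<B> UNIV lact"
    and lact_mult: "b1 \<in> \<B> \<Longrightarrow> b2 \<in> \<B> \<Longrightarrow> lact (mulB b1 b2) v = lact b1 (lact b2 v)"
    and lact_one: "lact e v = v"
    and ract_bilinear: "bilinear_on scale UNIV \<A> ract"
    and ract_mult: "a1 \<in> \<A> \<Longrightarrow> a2 \<in> \<A> \<Longrightarrow> ract v (mulA a1 a2) = ract (ract v a1) a2"
    and ract_one: "ract v e = v"
    and actions_commute: "b \<in> \<B> \<Longrightarrow> a \<in> \<A> \<Longrightarrow> ract (lact b v) a = lact b (ract v a)"
    and inter: "\<A> \<inter> \<B> = span {e}"
    and dim_inter: "dim (\<A> \<inter> \<B>) = 1"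
    \<comment> \<open>the quotient of \<open>\<L>\<close> by \<open>\<A> + \<B>\<close> is one-dimensional\<close>
    and codim_sum: "dim (UNIV :: 'l set) = dim {a + b | a b. a \<in> \<A> \<and> b \<in> \<B>} + 1"
    and lact_B: "b1 \<in> \<B> \<Longrightarrow> b2 \<in> \<B> \<Longrightarrow> lact b1 b2 = mulB b1 b2"
    and ract_A: "a1 \<in> \<A> \<Longrightarrow> a2 \<in> \<A> \<Longrightarrow> ract a1 a2 = mulA a1 a2"
    and form_A: "a1 \<in> \<A> \<Longrightarrow> a2 \<in> \<A> \<Longrightarrow> form a1 a2 = 0"
    and form_B: "b1 \<in> \<B> \<Longrightarrow> b2 \<in> \<B> \<Longrightarrow> form b1 b2 = 0"
    and form_lact: "b1 \<in> \<B> \<Longrightarrow> b2 \<in> \<B> \<Longrightarrow> form (mulB b1 b2) v = form b1 (lact b2 v)"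
    and form_ract: "a1 \<in> \<A> \<Longrightarrow> a2 \<in> \<A> \<Longrightarrow> form v (mulA a1 a2) = form (ract v a1) a2"

text \<open>
  Associative unital, not necessarily commutative, complex algebras; the library locale
  \<^locale>\<open>algebra\<close> is restricted to commutative ones.
\<close>

locale complex_algebra =
  Module.module "class_ring :: complex ring" U + ring U
  for U :: "(complex, 'u) module" (structure) +
  assumes smult_mult_left:
      "x \<in> carrier U \<Longrightarrow> y \<in> carrier U \<Longrightarrow> (c \<odot> x) \<otimes> y = c \<odot> (x \<otimes> y)"
    and smult_mult_right:
      "x \<in> carrier U \<Longrightarrow> y \<in> carrier U \<Longrightarrow> x \<otimes> (c \<odot> y) = c \<odot> (x \<otimes> y)"

definition algebra_hom ::
    "(complex, 'u) module \<Rightarrow> (complex, 'x) module \<Rightarrow> ('u \<Rightarrow> 'x) set" where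
  "algebra_hom U X =
     {h \<in> Ring.ring_hom U X. \<forall>c. \<forall>x\<in>carrier U. h (c \<odot>\<^bsub>U\<^esub> x) = c \<odot>\<^bsub>X\<^esub> h x}"

text \<open>
  Algebras \<open>X\<close> containing \<open>\<L>\<close>, via an injective linear map \<open>\<iota>\<close>, in which \<open>1 \<in> \<L>\<close> is the unit
  and \<open>bv\<close>, \<open>va\<close> are the given actions.
\<close>

locale algebra_extension = complex_algebra X
  for scale :: "complex \<Rightarrow> 'l::ab_group_add \<Rightarrow> 'l"
    and \<A> \<B> :: "'l set"
    and e :: 'l
    and lact ract :: "'l \<Rightarrow> 'l \<Rightarrow> 'l"
    and X :: "(complex, 'x) module" (structure)
    and \<iota> :: "'l \<Rightarrow> 'x" +
  assumes emb_closed: "\<iota> v \<in> carrier X"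
    and emb_inj: "inj \<iota>"
    and emb_add: "\<iota> (v + w) = \<iota> v \<oplus> \<iota> w"
    and emb_scale: "\<iota> (scale c v) = c \<odot> \<iota> v"
    and emb_one: "\<iota> e = \<one>"
    and emb_lact: "b \<in> \<B> \<Longrightarrow> \<iota> b \<otimes> \<iota> v = \<iota> (lact b v)"
    and emb_ract: "a \<in> \<A> \<Longrightarrow> \<iota> v \<otimes> \<iota> a = \<iota> (ract v a)"

text \<open>
  The weak M-algebra, characterised by its universal property. The test algebras \<open>X\<close> have
  arbitrary carriers and operations inside the type \<open>'u\<close> that also contains \<open>U\<close>, as a type
  variable cannot be quantified here. Nothing is lost: taking for \<open>X\<close> the subalgebra of \<open>U\<close>
  generated by \<open>\<L>\<close> shows that \<open>U\<close> is generated by \<open>\<L>\<close>; and an algebra generated by a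
  finite-dimensional space has at most the cardinality of the continuum, hence (\<open>\<L>\<close> being nonzero
  and contained in \<open>U\<close>) a copy inside \<open>'u\<close>, so that the property follows for \<open>X\<close> in any type.
\<close>

locale weak_M_algebra =
  weak_M_structure scale \<A> \<B> e form mulA mulB lact ract +
  U: algebra_extension scale \<A> \<B> e lact ract U \<iota>
  for scale :: "complex \<Rightarrow> 'l::ab_group_add \<Rightarrow> 'l"
    and \<A> \<B> :: "'l set"
    and e :: 'l
    and form :: "'l \<Rightarrow> 'l \<Rightarrow> complex"
    and mulA mulB lact ract :: "'l \<Rightarrow> 'l \<Rightarrow> 'l"
    and U :: "(complex, 'u) module" (structure)
    and \<iota> :: "'l \<Rightarrow> 'u" +
  assumes universal:
    "\<And>(X :: (complex, 'u) module) j. algebra_extension scale \<A> \<B> e lact ract X j \<Longrightarrow>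
       \<exists>h\<in>algebra_hom U X. (\<forall>v. h (\<iota> v) = j v) \<and>
         (\<forall>h'\<in>algebra_hom U X. (\<forall>v. h' (\<iota> v) = j v) \<longrightarrow> (\<forall>x\<in>carrier U. h' x = h x))"

locale adapted_basis =
  weak_M_structure scale \<A> \<B> e form mulA mulB lact ract
  for scale :: "complex \<Rightarrow> 'l::ab_group_add \<Rightarrow> 'l"
    and \<A> \<B> :: "'l set"
    and e :: 'l
    and form :: "'l \<Rightarrow> 'l \<Rightarrow> complex"
    and mulA mulB lact ract :: "'l \<Rightarrow> 'l \<Rightarrow> 'l"
    and p :: nat
    and A B :: "nat \<Rightarrow> 'l"
    and C :: 'l +
  assumes A_distinct: "inj_on A {1..p}" "e \<notin> A ` {1..p}"
    and A_independent: "independent (insert e (A ` {1..p}))"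
    and A_span: "span (insert e (A ` {1..p})) = \<A>"
    and B_distinct: "inj_on B {1..p}" "e \<notin> B ` {1..p}"
    and B_independent: "independent (insert e (B ` {1..p}))"
    and B_span: "span (insert e (B ` {1..p})) = \<B>"
    and form_A_B: "i \<in> {1..p} \<Longrightarrow> j \<in> {1..p} \<Longrightarrow> form (A i) (B j) = (if i = j then 1 else 0)"
    and form_one_C: "form e C = 1"
    and form_C_C: "form C C = 0"
    and form_C_A: "i \<in> {1..p} \<Longrightarrow> form C (A i) = 0"
    and form_C_B: "j \<in> {1..p} \<Longrightarrow> form C (B j) = 0"

definition K_element ::
    "(complex, 'u) module \<Rightarrow> ('l \<Rightarrow> 'u) \<Rightarrow> nat \<Rightarrow> (nat \<Rightarrow> 'l) \<Rightarrow> (nat \<Rightarrow> 'l) \<Rightarrow> 'l \<Rightarrow> 'u" where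
  "K_element U \<iota> p A B C =
     (\<Oplus>\<^bsub>U\<^esub>i\<in>{1..p}. \<iota> (A i) \<otimes>\<^bsub>U\<^esub> \<iota> (B i)) \<oplus>\<^bsub>U\<^esub> \<iota> C"

text \<open>
  An M-structure together with its algebra \<open>U(\<L>)\<close> and an adapted basis. Centrality is required
  of the \<open>K\<close> of the given basis only; \<open>K\<close> does not depend on the basis.
\<close>

locale M_structure =
  weak_M_algebra scale \<A> \<B> e form mulA mulB lact ract U \<iota> +
  adapted_basis scale \<A> \<B> e form mulA mulB lact ract p A B C
  for scale :: "complex \<Rightarrow> 'l::ab_group_add \<Rightarrow> 'l"
    and \<A> \<B> :: "'l set"
    and e :: 'l
    and form :: "'l \<Rightarrow> 'l \<Rightarrow> complex"
    and mulA mulB lact ract :: "'l \<Rightarrow> 'l \<Rightarrow> 'l"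
    and U :: "(complex, 'u) module" (structure)
    and \<iota> :: "'l \<Rightarrow> 'u"
    and p :: nat
    and A B :: "nat \<Rightarrow> 'l"
    and C :: 'l +
  assumes K_central:
    "x \<in> carrier U \<Longrightarrow> K_element U \<iota> p A B C \<otimes> x = x \<otimes> K_element U \<iota> p A B C"

end

theory Submission
  imports Defs
begin

text \<open>
  Let \<open>W\<close> be the span of the given elements. The right action turns \<open>v(abK\<^sup>s)\<close> into \<open>(va)bK\<^sup>s\<close> with
  \<open>va \<in> \<L> = \<A> + \<B> + \<complex>C\<close>, and the only product \<open>\<L>\<B>K\<^sup>s\<close> not visibly in \<open>W\<close> is \<open>C\<B>K\<^sup>s\<close>; it is
  rewritten by \<open>C = K - \<Sum>\<^sub>i A\<^sub>i B\<^sup>i\<close> with \<open>K\<close> central. Hence \<open>\<L>W \<subseteq> W\<close>. The elements \<open>x\<close> with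
  \<open>xW \<subseteq> W\<close> form a subalgebra containing \<open>\<L>\<close>, which is everything by the universal property; now
  apply it to \<open>1 \<in> W\<close>.
\<close>

section \<open>Linear subspaces and subalgebras of a complex algebra\<close>

context complex_algebra
begin

lemma submodule_minus_closed:
  assumes N: "LinearCombinations.submodule class_ring N U" and "x \<in> N" "y \<in> N"
  shows "x \<ominus> y \<in> N"
proof -
  interpret N: LinearCombinations.submodule class_ring N U by (fact N)
  have "\<ominus> y = (- 1) \<odot> y"
    using smult_minus_1[of y] N.subset \<open>y \<in> N\<close> by (auto simp: class_ring_simps)
  then show ?thesis
    using assms by (simp add: a_minus_def)
qed

lemma submodule_finsum_closed:
  assumes N: "LinearCombinations.submodule class_ring N U" and f: "\<And>i. i \<in> I \<Longrightarrow> f i \<in> N"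
  shows "finsum U f I \<in> N"
proof -
  interpret N: LinearCombinations.submodule class_ring N U by (fact N)
  show ?thesis
    using f
  \<comment> \<open>For infinite \<open>I\<close> the sum is zero by default, so no finiteness
    assumption is needed.\<close>
  proof (induction I rule: infinite_finite_induct)
    case (insert i I)
    moreover have "f \<in> I \<rightarrow> carrier U" "f i \<in> carrier U"
      using insert.prems N.subset by auto
    ultimately show ?case by simp
  qed auto
qed

text \<open>This and its right-hand counterpart reduce membership of products in \<open>N\<close> to
  generators, one factor at a time.\<close>

lemma submodule_vimage_mult_left:
  assumes N: "LinearCombinations.submodule class_ring N U" and x: "x \<in> carrier U"
  shows "LinearCombinations.submodule class_ring {y \<in> carrier U. x \<otimes> y \<in> N} U"
proof -
  interpret N: LinearCombinations.submodule class_ring N U by (fact N)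
  show ?thesis
    using x by unfold_locales (auto simp: r_distr smult_mult_right)
qed

lemma submodule_vimage_mult_right:
  assumes N: "LinearCombinations.submodule class_ring N U" and y: "y \<in> carrier U"
  shows "LinearCombinations.submodule class_ring {x \<in> carrier U. x \<otimes> y \<in> N} U"
proof -
  interpret N: LinearCombinations.submodule class_ring N U by (fact N)
  show ?thesis
    using y by unfold_locales (auto simp: l_distr smult_mult_left)
qed

lemma complex_algebra_subalgebra:
  assumes N: "LinearCombinations.submodule class_ring N U"
    and one: "\<one> \<in> N" and mult: "\<And>x y. x \<in> N \<Longrightarrow> y \<in> N \<Longrightarrow> x \<otimes> y \<in> N"
  shows "complex_algebra (U\<lparr>carrier := N\<rparr>)"
proof -
  interpret N: LinearCombinations.submodule class_ring N U by (fact N)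
  interpret M: Module.module class_ring "U\<lparr>carrier := N\<rparr>"
    by (rule submodule_is_module[OF N])
  have [simp]: "x \<in> carrier U" if "x \<in> N" for x
    using that N.subset by blast
  have "ring (U\<lparr>carrier := N\<rparr>)"
  proof (intro ringI M.abelian_group_axioms monoidI)
  qed (auto simp: one mult m_assoc l_distr r_distr)
  then show ?thesis
    by (intro complex_algebra.intro M.module_axioms complex_algebra_axioms.intro)
      (auto simp: smult_mult_left smult_mult_right)
qed

end

section \<open>Generation by \<open>\<iota>\<close> and decomposition of the underlying
  space\<close>

lemma (in weak_M_algebra) subalgebra_eq_carrier:
  assumes N: "LinearCombinations.submodule class_ring N U"
    and mult: "\<And>x y. x \<in> N \<Longrightarrow> y \<in> N \<Longrightarrow> x \<otimes> y \<in> N"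
    and emb: "\<And>v. \<iota> v \<in> N"
  shows "N = carrier U"
proof -
  interpret N: LinearCombinations.submodule class_ring N U by (fact N)
  let ?X = "U\<lparr>carrier := N\<rparr>"
  have one: "\<one> \<in> N"
    using emb[of e] by (simp add: U.emb_one)
  interpret X: complex_algebra ?X
    by (rule U.complex_algebra_subalgebra[OF N one mult])
  have "algebra_extension scale \<A> \<B> e lact ract ?X \<iota>"
    by unfold_locales
      (auto simp: emb U.emb_inj U.emb_add U.emb_scale U.emb_one U.emb_lact U.emb_ract)
  then obtain h where h: "h \<in> algebra_hom U ?X" and h_emb: "\<And>v. h (\<iota> v) = \<iota> v"
    using universal by blast
  \<comment> \<open>Composed with the inclusion of \<open>N\<close>, the universal map becomes an
    endomorphism of \<open>U\<close> that fixes the image of \<open>\<iota>\<close>. Uniqueness,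
    with \<open>U\<close> itself as test algebra, makes it the identity, so every
    \<open>x = h x\<close> lies in \<open>N\<close>.\<close>
  have h_U: "h \<in> algebra_hom U U"
    using h N.subset by (auto simp: algebra_hom_def Ring.ring_hom_def)
  have id_U: "(\<lambda>x. x) \<in> algebra_hom U U"
    by (auto simp: algebra_hom_def Ring.ring_hom_def)
  have "h x = x" if "x \<in> carrier U" for x
    using universal[OF U.algebra_extension_axioms] h_U id_U h_emb that by metis
  moreover have "h x \<in> N" if "x \<in> carrier U" for x
    using h that by (auto simp: algebra_hom_def Ring.ring_hom_def)
  ultimately show ?thesis
    using N.subset by force
qed

text \<open>Passes from HOL-Algebra submodules to subspaces of the type \<open>'l\<close>, so that
  \<open>span_minimal\<close> applies to the bases of \<open>\<A>\<close> and
  \<open>\<B>\<close>.\<close>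

lemma (in algebra_extension) subspace_vimage_emb:
  assumes "vector_space scale" and N: "LinearCombinations.submodule class_ring N X"
  shows "module.subspace scale {v. \<iota> v \<in> N}"
proof -
  interpret V: vector_space scale by fact
  interpret N: LinearCombinations.submodule class_ring N X by (fact N)
  have "\<iota> 0 = \<zero>"
    using emb_scale[of 0 e] emb_closed[of e] by (simp add: lmult_0[unfolded class_ring_simps])
  then show ?thesis
    by (auto simp: V.subspace_def emb_add emb_scale)
qed

text \<open>Since \<open>e\<close> lies in both isotropic subspaces \<open>\<A>\<close> and
  \<open>\<B>\<close>, it is orthogonal to their sum. As \<open>form e C = 1\<close>, the vector
  \<open>C\<close> lies outside that sum, which has codimension one.\<close>

lemma (in adapted_basis) decomposition:
  obtains a b c where "a \<in> \<A>" "b \<in> \<B>" "v = a + b + scale c C"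
proof -
  let ?S = "{a + b | a b. a \<in> \<A> \<and> b \<in> \<B>}"
  obtain S where S: "finite S" "span S = UNIV"
    using finite_dim by blast
  obtain D where D: "independent D" "UNIV \<subseteq> span D"
    using basis_exists[of UNIV] by metis
  \<comment> \<open>A finite basis, extracted from the finite spanning set, gives access to the
    dimension formulas used below.\<close>
  interpret F: finite_dimensional_vector_space scale D
    using independent_span_bound[OF S(1) D(1)] S(2) D by unfold_locales auto
  have e: "e \<in> \<A>" "e \<in> \<B>"
    using product_A product_B by (auto simp: unital_product_on_def)
  have subS: "subspace ?S"
    using subspace_sums subspace_A subspace_B by blast
  have spanS: "span ?S = ?S"
    using subS by (simp only: span_eq_iff)
  have "form e (a + b) = 0" if "a \<in> \<A>" "b \<in> \<B>" for a b
    using form_A[OF e(1) that(1)] form_B[OF e(2) that(2)]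
      module_hom.add[OF Vector_Spaces.linear.axioms(3)[OF form_linear], of e a b] by simp
  then have "C \<notin> span ?S"
    unfolding spanS using form_one_C by force
  then have "dim (insert C ?S) = dim (UNIV :: 'l set)"
    unfolding F.dim_insert codim_sum by simp
  then have "span (insert C ?S) = UNIV"
    using F.dim_eq_full[of "insert C ?S"] F.dim_eq_full[of UNIV] span_UNIV by argo
  then have "v \<in> span (insert C ?S)"
    by simp
  then obtain c where "v - scale c C \<in> ?S"
    unfolding span_insert spanS by blast
  then obtain a b where "a \<in> \<A>" "b \<in> \<B>" "v - scale c C = a + b"
    by blast
  then show ?thesis
    using that[of a b c] by (simp add: algebra_simps)
qed

section \<open>Normal forms and the stability of their span\<close>

context M_structure
begin

abbreviation K :: 'u where
  "K \<equiv> K_element U \<iota> p A B C"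

definition normal_forms :: "'u set" where
  "normal_forms =
     {K [^] s | s :: nat. True} \<union>
     {\<iota> (A i) \<otimes> K [^] s | i (s :: nat). i \<in> {1..p}} \<union>
     {\<iota> (B j) \<otimes> K [^] s | j (s :: nat). j \<in> {1..p}} \<union>
     {\<iota> (A i) \<otimes> \<iota> (B j) \<otimes> K [^] s | i j (s :: nat). i \<in> {1..p} \<and> j \<in> {1..p}}"

lemma K_closed: "K \<in> carrier U"
  by (auto simp: K_element_def U.emb_closed)

lemmas closed = U.emb_closed K_closed

lemma normal_forms_subset: "normal_forms \<subseteq> carrier U"
  by (auto simp: normal_forms_def closed)

lemma submodule_span_normal_forms:
  "LinearCombinations.submodule class_ring (U.span normal_forms) U"
  by (rule U.span_is_submodule[OF normal_forms_subset])

sublocale W: LinearCombinations.submodule class_ring "U.span normal_forms" U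
  by (rule submodule_span_normal_forms)

lemma A_in: "i \<in> {1..p} \<Longrightarrow> A i \<in> \<A>" and B_in: "i \<in> {1..p} \<Longrightarrow> B i \<in> \<B>"
  and e_in: "e \<in> \<A>" "e \<in> \<B>"
  unfolding A_span[symmetric] B_span[symmetric] by (auto intro: span_base)

text \<open>Allowing \<open>e\<close>, whose image is the unit, as either factor merges the four
  families into one shape.\<close>

lemma normal_form_cases:
  assumes "x \<in> normal_forms"
  obtains a b and s :: nat where "a \<in> \<A>" "b \<in> \<B>" "x = \<iota> a \<otimes> (\<iota> b \<otimes> K [^] s)"
  using assms that[OF e_in(1) e_in(2)] that[OF A_in e_in(2)] that[OF e_in(1) B_in] that[OF A_in B_in]
  unfolding normal_forms_def by (fastforce simp: U.emb_one closed U.m_assoc)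

lemma normal_form_AB_basis:
  assumes "a \<in> insert e (A ` {1..p})" "b \<in> insert e (B ` {1..p})"
  shows "\<iota> a \<otimes> (\<iota> b \<otimes> K [^] (s :: nat)) \<in> normal_forms"
proof -
  consider "a = e" "b = e" | i where "a = A i" "b = e" "i \<in> {1..p}"
    | j where "a = e" "b = B j" "j \<in> {1..p}"
    | i j where "a = A i" "b = B j" "i \<in> {1..p}" "j \<in> {1..p}"
    using assms by blast
  then show ?thesis
    unfolding normal_forms_def
    by cases (simp_all add: U.emb_one closed U.m_assoc, blast+)
qed

text \<open>The product is linear in \<open>a\<close> and in \<open>b\<close>: first
  \<open>b\<close> varies with \<open>a\<close> a basis vector, then \<open>a\<close> varies with
  \<open>b\<close> fixed.\<close>

lemma normal_form_AB:
  assumes a: "a \<in> \<A>" and b: "b \<in> \<B>"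
  shows "\<iota> a \<otimes> (\<iota> b \<otimes> K [^] (s :: nat)) \<in> U.span normal_forms"
proof -
  note sub = U.subspace_vimage_emb[OF vector_space_axioms]
  have *: "\<iota> a' \<otimes> (\<iota> b \<otimes> K [^] s) \<in> U.span normal_forms" if a': "a' \<in> insert e (A ` {1..p})" for a'
  proof -
    \<comment> \<open>The nesting mirrors the two preimage lemmas, which then apply by
      unification.\<close>
    have "subspace {b. \<iota> b \<in> {x \<in> carrier U. x \<otimes> K [^] s \<in>
        {y \<in> carrier U. \<iota> a' \<otimes> y \<in> U.span normal_forms}}}" (is "subspace ?S")
      by (intro sub U.submodule_vimage_mult_right U.submodule_vimage_mult_left
          submodule_span_normal_forms closed U.nat_pow_closed)
    moreover have "insert e (B ` {1..p}) \<subseteq> ?S"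
      using normal_form_AB_basis[OF a'] U.in_own_span[OF normal_forms_subset] closed by blast
    ultimately have "\<B> \<subseteq> ?S"
      unfolding B_span[symmetric] by (rule span_minimal[rotated])
    with b show ?thesis by blast
  qed
  have "subspace {a. \<iota> a \<in> {x \<in> carrier U. x \<otimes> (\<iota> b \<otimes> K [^] s) \<in> U.span normal_forms}}"
    (is "subspace ?S")
    by (intro sub U.submodule_vimage_mult_right submodule_span_normal_forms
        closed U.nat_pow_closed U.m_closed)
  moreover have "insert e (A ` {1..p}) \<subseteq> ?S"
    using * closed by blast
  ultimately have "\<A> \<subseteq> ?S"
    unfolding A_span[symmetric] by (rule span_minimal[rotated])
  with a show ?thesis by blast
qed

lemma emb_C_eq: "\<iota> C = K \<ominus> (\<Oplus>i\<in>{1..p}. \<iota> (A i) \<otimes> \<iota> (B i))"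
proof -
  have "(\<Oplus>i\<in>{1..p}. \<iota> (A i) \<otimes> \<iota> (B i)) \<in> carrier U"
    by (auto simp: U.emb_closed)
  then show ?thesis
    by (simp add: K_element_def a_minus_def U.a_ac U.emb_closed U.r_neg)
qed

lemma emb_C_mult:
  assumes b: "b \<in> \<B>"
  shows "\<iota> C \<otimes> (\<iota> b \<otimes> K [^] (s :: nat)) \<in> U.span normal_forms"
proof -
  let ?y = "\<iota> b \<otimes> K [^] s"
  \<comment> \<open>By \<open>emb_C_eq\<close> it suffices that this subspace contains
    \<open>K\<close> and every product of \<open>\<iota> (A i)\<close> and
    \<open>\<iota> (B i)\<close>.\<close>
  let ?N = "{x \<in> carrier U. x \<otimes> ?y \<in> U.span normal_forms}"
  have N: "LinearCombinations.submodule class_ring ?N U"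
    by (intro U.submodule_vimage_mult_right submodule_span_normal_forms
        closed U.nat_pow_closed U.m_closed)
  \<comment> \<open>Centrality of \<open>K\<close> enters here; it raises the exponent to
    \<open>Suc s\<close>.\<close>
  have "K \<otimes> ?y = ?y \<otimes> K"
    by (intro K_central U.m_closed closed U.nat_pow_closed)
  also have "\<dots> = \<iota> e \<otimes> (\<iota> b \<otimes> K [^] Suc s)"
    by (simp add: U.emb_one closed U.m_assoc)
  finally have "K \<in> ?N"
    using normal_form_AB[OF e_in(1) b, of "Suc s"] closed by simp
  moreover have "\<iota> (A i) \<otimes> \<iota> (B i) \<in> ?N" if i: "i \<in> {1..p}" for i
  proof -
    \<comment> \<open>The two adjacent factors from \<open>\<B>\<close> multiply inside
      \<open>\<B>\<close>, which restores the normal shape.\<close>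
    have "mulB (B i) b \<in> \<B>"
      using product_B B_in[OF i] b by (auto simp: unital_product_on_def)
    moreover have "\<iota> (A i) \<otimes> \<iota> (B i) \<otimes> ?y = \<iota> (A i) \<otimes> (\<iota> (B i) \<otimes> \<iota> b \<otimes> K [^] s)"
      by (simp add: closed U.m_assoc)
    then have "\<iota> (A i) \<otimes> \<iota> (B i) \<otimes> ?y = \<iota> (A i) \<otimes> (\<iota> (mulB (B i) b) \<otimes> K [^] s)"
      by (simp add: U.emb_lact[OF B_in[OF i]] lact_B[OF B_in[OF i] b])
    ultimately show ?thesis
      using normal_form_AB[OF A_in[OF i]] closed by simp
  qed
  ultimately have "\<iota> C \<in> ?N"
    unfolding emb_C_eq
    by (intro U.submodule_minus_closed[OF N] U.submodule_finsum_closed[OF N])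
  then show ?thesis by simp
qed

text \<open>Split \<open>v\<close> by \<open>decomposition\<close>: the part in \<open>\<A>\<close>
  is already normal, the part in \<open>\<B>\<close> merges with \<open>b\<close>, and the multiple
  of \<open>C\<close> is covered by \<open>emb_C_mult\<close>.\<close>

lemma emb_mult_BK:
  assumes b: "b \<in> \<B>"
  shows "\<iota> v \<otimes> (\<iota> b \<otimes> K [^] (s :: nat)) \<in> U.span normal_forms"
proof -
  let ?y = "\<iota> b \<otimes> K [^] s"
  have y: "?y \<in> carrier U"
    by (simp add: closed)
  obtain a b' c where v: "a \<in> \<A>" "b' \<in> \<B>" "v = a + b' + scale c C"
    by (rule decomposition)
  have "mulB b' b \<in> \<B>"
    using product_B v(2) b by (auto simp: unital_product_on_def)
  moreover have "\<iota> b' \<otimes> ?y = \<iota> e \<otimes> (\<iota> (mulB b' b) \<otimes> K [^] s)"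
    using U.emb_lact[OF v(2), of b] lact_B[OF v(2) b]
    by (simp add: U.emb_one closed flip: U.m_assoc)
  ultimately have "\<iota> b' \<otimes> ?y \<in> U.span normal_forms"
    using normal_form_AB[OF e_in(1)] by simp
  moreover have "\<iota> v \<otimes> ?y = \<iota> a \<otimes> ?y \<oplus> \<iota> b' \<otimes> ?y \<oplus> c \<odot> (\<iota> C \<otimes> ?y)"
    using y by (simp add: v(3) U.emb_add U.emb_scale closed U.l_distr U.smult_mult_left
        class_ring_simps)
  ultimately show ?thesis
    using normal_form_AB[OF v(1) b] emb_C_mult[OF b] by simp
qed

text \<open>On generators the right action absorbs the factor from \<open>\<A>\<close> into
  \<open>v\<close>, which leaves the case of \<open>emb_mult_BK\<close>.\<close>

lemma emb_mult_span:
  assumes w: "w \<in> U.span normal_forms"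
  shows "\<iota> v \<otimes> w \<in> U.span normal_forms"
proof -
  let ?N = "{y \<in> carrier U. \<iota> v \<otimes> y \<in> U.span normal_forms}"
  have "normal_forms \<subseteq> ?N"
  proof
    fix x assume x: "x \<in> normal_forms"
    then obtain a b and s :: nat where
      ab: "a \<in> \<A>" "b \<in> \<B>" and x_eq: "x = \<iota> a \<otimes> (\<iota> b \<otimes> K [^] s)"
      by (rule normal_form_cases)
    have "\<iota> v \<otimes> x = \<iota> (ract v a) \<otimes> (\<iota> b \<otimes> K [^] s)"
      by (simp add: x_eq closed flip: U.m_assoc U.emb_ract[OF ab(1)])
    then show "x \<in> ?N"
      using emb_mult_BK[OF ab(2)] x normal_forms_subset by auto
  qed
  then have "U.span normal_forms \<subseteq> ?N"
    by (rule U.span_is_subset)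
      (rule U.submodule_vimage_mult_left[OF submodule_span_normal_forms U.emb_closed])
  then show ?thesis
    using w by blast
qed

lemma span_normal_forms: "U.span normal_forms = carrier U"
proof
  show "U.span normal_forms \<subseteq> carrier U"
    by (rule W.subset)
  \<comment> \<open>The left stabilizer of the span is closed under products by associativity, even
    though the span itself is not yet known to be.\<close>
  let ?T = "{x \<in> carrier U. \<forall>w\<in>U.span normal_forms. x \<otimes> w \<in> U.span normal_forms}"
  have sub: "w \<in> carrier U" if "w \<in> U.span normal_forms" for w
    using that W.subset by blast
  have "LinearCombinations.submodule class_ring ?T U"
    by unfold_locales (auto simp: sub U.l_distr U.smult_mult_left)
  then have "?T = carrier U"
    by (rule subalgebra_eq_carrier) (auto simp: sub U.m_assoc closed emb_mult_span)
  moreover have "\<one> \<in> U.span normal_forms"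
    using normal_form_AB[OF e_in, of 0] by (simp add: U.emb_one)
  ultimately show "carrier U \<subseteq> U.span normal_forms"
    by force
qed

end

theorem theorem2p4:
  fixes scale :: "complex \<Rightarrow> 'l::ab_group_add \<Rightarrow> 'l"
    and \<A> \<B> :: "'l set"
    and e :: 'l
    and form :: "'l \<Rightarrow> 'l \<Rightarrow> complex"
    and mulA mulB lact ract :: "'l \<Rightarrow> 'l \<Rightarrow> 'l"
    and U :: "(complex, 'u) module"
    and \<iota> :: "'l \<Rightarrow> 'u"
    and p :: nat
    and A B :: "nat \<Rightarrow> 'l"
    and C :: 'l
    and K :: 'u
  assumes "M_structure scale \<A> \<B> e form mulA mulB lact ract U \<iota> p A B C"
    and "K = K_element U \<iota> p A B C"
  shows "LinearCombinations.module.span class_ring U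
      ({K [^]\<^bsub>U\<^esub> s | s :: nat. True} \<union>
       {\<iota> (A i) \<otimes>\<^bsub>U\<^esub> K [^]\<^bsub>U\<^esub> s | i (s :: nat). i \<in> {1..p}} \<union>
       {\<iota> (B j) \<otimes>\<^bsub>U\<^esub> K [^]\<^bsub>U\<^esub> s | j (s :: nat). j \<in> {1..p}} \<union>
       {\<iota> (A i) \<otimes>\<^bsub>U\<^esub> \<iota> (B j) \<otimes>\<^bsub>U\<^esub> K [^]\<^bsub>U\<^esub> s | i j (s :: nat).
          i \<in> {1..p} \<and> j \<in> {1..p}}) = carrier U"
  using M_structure.span_normal_forms[OF assms(1)]
  unfolding M_structure.normal_forms_def[OF assms(1)] assms(2) .

end
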